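(* Let $f_1,\dots,f_m:\mathbb{R}^d\to\mathbb{R}$ be twice continuously differentiable and $F=\sum_{i=1}^m f_i$. Assume: (1) the delayed iteration indices $\tau_i^k$ satisfy $0\le k-\tau_i^k\le K$ for all $i,k$ and some $K\ge 0$; (2) $F$ is $\mu$-strongly convex and $L$-smooth with $L\ge\mu>0$; (3) for each $i$ the Hessian $\nabla^2 f_i$ is $L_{H,i}$-Lipschitz continuous, and put $L_H=\sum_{i=1}^m L_{H,i}$. Let $\{\theta^k\}_{k\ge1}$ be generated by the CIAG method (see context) with step size $\gamma=c/(\mu+L)$, $c>0$. Let $\theta^\star$ be the minimizer of $F$ and $V^{(k)}=\|\theta^k-\theta^\star\|^2$. If $$c<\min\Big\{2,\ \frac1K\sqrt{\frac{\mu L(\mu+L)}{2L_H\big(L^2 (V^{(1)})^{1/2}+4L_H^2 (V^{(1)})^{3/2}\big)}},\ \Big(\frac1{K^4}\,\frac{\mu L(\mu+L)^4}{2L_H^2\big(L^4V^{(1)}+16L_H^4 (V^{(1)})^3\big)}\Big)^{1/5}\Big\},$$ then there exists $\delta\in\big[1-2\gamma\frac{\mu L}{L+\mu},\,1\big)$ such that $$V^{(k)}\le\delta^{\lceil (k-1)/(2K+1)\rceil}\,V^{(1)}\qquad\text{for all }k\ge1.$$ Moreover, there exists a sequence $\{\bar V^{(k)}\}_{k\ge1}$ with $\bar V^{(k)}\ge V^{(k)}$ for all $k\ge1$ and $\bar V^{(1)}=V^{(1)}$ such that $$\lim_{k\to\infty}\frac{\bar V^{(k+1)}}{\bar V^{(k)}}\le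 1-2\gamma\frac{\mu L}{L+\mu}=1-\mathcal{O}\Big(\frac{c}{\kappa(F)}\Big),\qquad \kappa(F)=L/\mu .$$
   Context: $\|\cdot\|$ is the Euclidean norm (for matrices, the induced operator norm). $f$ is $L$-smooth if $f(\theta')\le f(\theta)+\langle\nabla f(\theta),\theta'-\theta\rangle+\frac L2\|\theta'-\theta\|^2$ for all $\theta,\theta'$, and $\mu$-strongly convex if $f(\theta')\ge f(\theta)+\langle\nabla f(\theta),\theta'-\theta\rangle+\frac\mu2\|\theta'-\theta\|^2$ for all $\theta,\theta'$. Delayed indices: at iteration $k\ge1$ an index $i_k\in\{1,\dots,m\}$ is selected, and $\tau_i^k=\max\{\tau\le k: i_\tau=i\}$ is the last iteration, up to and including $k$, at which component $i$ was accessed. The method is assumed to be initialized with all components at $\theta^1$, so that $\tau_i^k=1$ if $i$ has not been selected in iterations $1,\dots,k$; thus $1\le\tau_i^k\le k$ always. CIAG method: from an arbitrary $\theta^1\in\mathbb{R}^d$, for $k\ge1$, $$\theta^{k+1}=\theta^k-\gamma g^k,\qquad g^k=\sum_{i=1}^m\Big(\nabla f_i(\theta^{\tau_i^k})+\nabla^2 f_i(\theta^{\tau_i^k})(\theta^k-\theta^{\tau_i^k})\Big).$$ Quotients with zero denominator in the step size bound (e.g. when $K=0$, $L_H=0$ or $V^{(1)}=0$) are read as $+\infty$. *)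

theory Defs
  imports
    "HOL-Analysis.Analysis"
    "HOL-Library.Landau_Symbols"
begin

definition gradient :: "('a::real_inner \<Rightarrow> real) \<Rightarrow> 'a \<Rightarrow> 'a" where
  "gradient f x = (THE D. GDERIV f x :> D)"

definition hessian :: "(real^'d \<Rightarrow> real) \<Rightarrow> real^'d \<Rightarrow> real^'d^'d" where
  "hessian f x = jacobian (gradient f) (at x)"

text \<open>The differentiability clauses make \<^term>\<open>gradient f\<close> and \<^term>\<open>hessian f\<close>
  meaningful at every point.\<close>

definition twice_continuously_differentiable :: "(real^'d \<Rightarrow> real) \<Rightarrow> bool" where
  "twice_continuously_differentiable f \<longleftrightarrow>
     (\<forall>x. f differentiable (at x)) \<and>
     (\<forall>x. gradient f differentiable (at x)) \<and>
     continuous_on UNIV (hessian f)"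

text \<open>The norm of type \<^typ>\<open>real^'d^'d\<close> provided by the library is the Frobenius norm,
  so the induced operator norm has to be named explicitly.\<close>

definition op_norm :: "real^'d^'d \<Rightarrow> real" where
  "op_norm A = onorm ((*v) A)"

definition hessian_lipschitz :: "real \<Rightarrow> (real^'d \<Rightarrow> real) \<Rightarrow> bool" where
  "hessian_lipschitz C f \<longleftrightarrow>
     0 \<le> C \<and> (\<forall>x y. op_norm (hessian f x - hessian f y) \<le> C * norm (x - y))"

definition smooth_fun :: "real \<Rightarrow> ('a::real_inner \<Rightarrow> real) \<Rightarrow> bool" where
  "smooth_fun L f \<longleftrightarrow>
     (\<forall>x y. f y \<le> f x + gradient f x \<bullet> (y - x) + L / 2 * (norm (y - x))\<^sup>2)"

definition strongly_convex :: "real \<Rightarrow> ('a::real_inner \<Rightarrow> real) \<Rightarrow> bool" where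
  "strongly_convex \<mu> f \<longleftrightarrow>
     (\<forall>x y. f y \<ge> f x + gradient f x \<bullet> (y - x) + \<mu> / 2 * (norm (y - x))\<^sup>2)"

text \<open>\<^term>\<open>idx k\<close> is the component selected at iteration \<^term>\<open>k\<close>. Iterations are
  counted from 1; the value \<^term>\<open>idx 0\<close> is irrelevant. A component that has not been
  selected in iterations \<open>1, \<dots>, k\<close> still carries its initial information, taken at
  iterate 1.\<close>

definition last_access :: "(nat \<Rightarrow> nat) \<Rightarrow> nat \<Rightarrow> nat \<Rightarrow> nat" where
  "last_access idx i k =
     (if \<exists>t\<in>{1..k}. idx t = i then Max {t \<in> {1..k}. idx t = i} else 1)"

definition ciag_direction ::
  "nat \<Rightarrow> (nat \<Rightarrow> real^'d \<Rightarrow> real) \<Rightarrow> (nat \<Rightarrow> nat) \<Rightarrow> (nat \<Rightarrow> real^'d) \<Rightarrow> nat \<Rightarrow> real^'d" where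
  "ciag_direction m f idx \<theta> k =
     (\<Sum>i=1..m.
        gradient (f i) (\<theta> (last_access idx i k)) +
        hessian (f i) (\<theta> (last_access idx i k)) *v (\<theta> k - \<theta> (last_access idx i k)))"

definition ciag_iterates ::
  "nat \<Rightarrow> (nat \<Rightarrow> real^'d \<Rightarrow> real) \<Rightarrow> (nat \<Rightarrow> nat) \<Rightarrow> real \<Rightarrow> (nat \<Rightarrow> real^'d) \<Rightarrow> bool" where
  "ciag_iterates m f idx \<gamma> \<theta> \<longleftrightarrow>
     (\<forall>k\<ge>1. idx k \<in> {1..m}) \<and>
     (\<forall>k\<ge>1. \<theta> (k + 1) = \<theta> k - \<gamma> *\<^sub>R ciag_direction m f idx \<theta> k)"

text \<open>A quotient with zero denominator counts as \<open>+\<infinity>\<close> here, unlike in HOL where it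
  is 0; hence the case distinctions and the type \<^typ>\<open>ereal\<close>. The numerators are positive
  whenever \<open>0 < \<mu> \<le> L\<close>. \<^term>\<open>V1\<close> stands for the squared initial distance to the minimizer.\<close>

definition step_bound_2 :: "nat \<Rightarrow> real \<Rightarrow> real \<Rightarrow> real \<Rightarrow> real \<Rightarrow> ereal" where
  "step_bound_2 K \<mu> L LH V1 =
     (let D = 2 * LH * (L ^ 2 * V1 powr (1/2) + 4 * LH ^ 2 * V1 powr (3/2))
      in if K = 0 \<or> D = 0 then \<infinity>
         else ereal (1 / real K * sqrt (\<mu> * L * (\<mu> + L) / D)))"

definition step_bound_3 :: "nat \<Rightarrow> real \<Rightarrow> real \<Rightarrow> real \<Rightarrow> real \<Rightarrow> ereal" where
  "step_bound_3 K \<mu> L LH V1 =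
     (let D = 2 * LH ^ 2 * (L ^ 4 * V1 + 16 * LH ^ 4 * V1 ^ 3)
      in if K = 0 \<or> D = 0 then \<infinity>
         else ereal ((1 / real K ^ 4 * (\<mu> * L * (\<mu> + L) ^ 4 / D)) powr (1/5)))"

end

theory Submission
  imports Defs
begin

text \<open>The CIAG direction is \<open>\<nabla>F(\<theta>\<^sup>k) + e\<^sup>k\<close>. A gradient step contracts the squared distance \<open>V\<close> by
  \<open>\<rho> = 1 - 2\<gamma>\<mu>L/(\<mu>+L)\<close>, while Taylor's formula makes \<open>e\<^sup>k\<close> quadratic in the movement of the
  iterates over the last \<open>K\<close> steps, and that movement is controlled by \<open>V\<close> over the last \<open>2K\<close> steps.
  With \<open>M\<^sup>k\<close> the maximum of \<open>V\<close> on this window, \<open>V\<^sup>k\<^sup>+\<^sup>1 \<le> \<rho>V\<^sup>k + \<epsilon>(M\<^sup>k)M\<^sup>k\<close> where \<open>\<epsilon>\<close> is increasing and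
  vanishes at \<open>0\<close>. The step size bound says exactly that \<open>\<delta> = \<rho> + \<epsilon>(V\<^sup>1) < 1\<close>, which gives linear
  convergence with delay; then \<open>\<epsilon>(M\<^sup>k)\<close> tends to \<open>0\<close>, and the ratio of a majorant tends to \<open>\<rho>\<close>.\<close>

section \<open>Gradients and Hessians\<close>

text \<open>Uniqueness behind the \<open>THE\<close>: two vectors inducing the same functional agree
  when tested on their own difference.\<close>

lemma gradient_eqI:
  assumes "GDERIV f x :> D"
  shows "gradient f x = D"
  unfolding gradient_def
proof (rule the_equality)
  fix E assume "GDERIV f x :> E"
  then have "(\<lambda>h. h \<bullet> E) = (\<lambda>h. h \<bullet> D)"
    using assms unfolding gderiv_def by (rule has_derivative_unique)
  then have "(E - D) \<bullet> E = (E - D) \<bullet> D"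
    by (rule fun_cong)
  then have "(E - D) \<bullet> (E - D) = 0"
    by (simp add: inner_diff_right)
  then show "E = D"
    by simp
qed (fact assms)

text \<open>In finite dimension the Riesz vector of the derivative can be written down explicitly
  from its values on \<open>Basis\<close>, so differentiability suffices for the \<open>THE\<close>
  to denote a gradient.\<close>

lemma gderiv_gradient:
  fixes f :: "'a::euclidean_space \<Rightarrow> real"
  assumes "f differentiable (at x)"
  shows "GDERIV f x :> gradient f x"
proof -
  obtain f' where f': "(f has_derivative f') (at x)"
    using assms by (auto simp: differentiable_def)
  interpret f': bounded_linear f'
    using f' by (rule has_derivative_bounded_linear)
  define D where "D = (\<Sum>b\<in>Basis. f' b *\<^sub>R b)"
  have "f' h = h \<bullet> D" for h
  proof -
    have "f' h = f' (\<Sum>b\<in>Basis. (h \<bullet> b) *\<^sub>R b)"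
      by (simp add: euclidean_representation)
    also have "\<dots> = h \<bullet> D"
      by (simp add: f'.sum f'.scaleR D_def inner_sum_right mult.commute)
    finally show ?thesis .
  qed
  then have "f' = (\<lambda>h. h \<bullet> D)"
    by auto
  then have "GDERIV f x :> D"
    using f' by (simp add: gderiv_def)
  then show ?thesis
    by (simp add: gradient_eqI)
qed

lemma gradient_sum:
  fixes f :: "'i \<Rightarrow> 'a::euclidean_space \<Rightarrow> real"
  assumes "\<And>i. i \<in> I \<Longrightarrow> f i differentiable (at x)"
  shows "gradient (\<lambda>x. \<Sum>i\<in>I. f i x) x = (\<Sum>i\<in>I. gradient (f i) x)"
proof (rule gradient_eqI)
  have "((\<lambda>x. \<Sum>i\<in>I. f i x) has_derivative (\<lambda>h. \<Sum>i\<in>I. h \<bullet> gradient (f i) x)) (at x)"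
    using gderiv_gradient[OF assms] by (intro has_derivative_sum) (auto simp: gderiv_def)
  then show "GDERIV (\<lambda>x. \<Sum>i\<in>I. f i x) x :> (\<Sum>i\<in>I. gradient (f i) x)"
    by (simp add: gderiv_def inner_sum_right)
qed

lemma norm_matrix_vector_le_op_norm: "norm (A *v x) \<le> op_norm A * norm x"
  unfolding op_norm_def by (intro onorm matrix_vector_mul_bounded_linear)

lemma gradient_has_derivative_hessian:
  assumes "twice_continuously_differentiable f"
  shows "(gradient f has_derivative (\<lambda>h. hessian f x *v h)) (at x)"
  using assms unfolding twice_continuously_differentiable_def hessian_def
  by (simp flip: jacobian_works)

text \<open>The vector remainder is tested against itself, which reduces the estimate to
  monotonicity of one real function and avoids integrating a vector-valued map.\<close>

lemma gradient_taylor_bound: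
  fixes f :: "real^'d \<Rightarrow> real"
  assumes f: "twice_continuously_differentiable f" and lip: "hessian_lipschitz C f"
  shows "norm (gradient f x + hessian f x *v (y - x) - gradient f y) \<le> C / 2 * (norm (y - x))\<^sup>2"
proof -
  define h where "h = y - x"
  define u where "u = gradient f y - gradient f x - hessian f x *v h"
  \<comment> \<open>Progress of the remainder along the segment, in direction \<open>u\<close>,
    minus the integral of the Lipschitz bound on its derivative; the 1/2 in the claim is the one in
    \<open>t\<^sup>2 / 2\<close>.\<close>
  define \<phi> where "\<phi> t = u \<bullet> (gradient f (x + t *\<^sub>R h) - t *\<^sub>R (hessian f x *v h))
    - norm u * C * (norm h)\<^sup>2 * (t\<^sup>2 / 2)" for t
  define \<phi>' where "\<phi>' t = u \<bullet> (hessian f (x + t *\<^sub>R h) *v h - hessian f x *v h)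
    - norm u * C * (norm h)\<^sup>2 * t" for t
  have deriv: "(\<phi> has_real_derivative \<phi>' t) (at t)" for t
  proof -
    have "((\<lambda>t. gradient f (x + t *\<^sub>R h)) has_derivative
        (\<lambda>s. hessian f (x + t *\<^sub>R h) *v (s *\<^sub>R h))) (at t)"
      by (rule has_derivative_compose[OF _ gradient_has_derivative_hessian[OF f]])
         (auto intro!: derivative_eq_intros)
    then have "((\<lambda>t. gradient f (x + t *\<^sub>R h)) has_vector_derivative
        hessian f (x + t *\<^sub>R h) *v h) (at t)"
      by (simp add: has_vector_derivative_def matrix_vector_mult_scaleR)
    then have "((\<lambda>t. gradient f (x + t *\<^sub>R h) - t *\<^sub>R (hessian f x *v h)) has_vector_derivative
        hessian f (x + t *\<^sub>R h) *v h - hessian f x *v h) (at t)"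
      by (auto intro!: derivative_eq_intros)
    then have "((\<lambda>t. u \<bullet> (gradient f (x + t *\<^sub>R h) - t *\<^sub>R (hessian f x *v h))) has_real_derivative
        u \<bullet> (hessian f (x + t *\<^sub>R h) *v h - hessian f x *v h)) (at t)"
      unfolding has_real_derivative_iff_has_vector_derivative
      by (rule bounded_linear.has_vector_derivative[OF bounded_linear_inner_right])
    then show ?thesis
      unfolding \<phi>_def \<phi>'_def by (auto intro!: derivative_eq_intros)
  qed
  have "\<phi>' t \<le> 0" if "0 \<le> t" for t
  proof -
    have "norm (hessian f (x + t *\<^sub>R h) *v h - hessian f x *v h)
        \<le> op_norm (hessian f (x + t *\<^sub>R h) - hessian f x) * norm h"
      by (metis matrix_vector_mult_diff_rdistrib norm_matrix_vector_le_op_norm)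
    also have "\<dots> \<le> C * norm (t *\<^sub>R h) * norm h"
      using lip unfolding hessian_lipschitz_def
      by (intro mult_right_mono) (metis add_diff_cancel_left', simp)
    also have "\<dots> = C * (norm h)\<^sup>2 * t"
      using that by (simp add: power2_eq_square)
    finally have "norm u * norm (hessian f (x + t *\<^sub>R h) *v h - hessian f x *v h)
        \<le> norm u * (C * (norm h)\<^sup>2 * t)"
      by (rule mult_left_mono) simp
    then show ?thesis
      unfolding \<phi>'_def
      using norm_cauchy_schwarz[of u "hessian f (x + t *\<^sub>R h) *v h - hessian f x *v h"]
      by (simp add: mult.assoc)
  qed
  then have "\<phi> 1 \<le> \<phi> 0"
    using deriv by (intro DERIV_nonpos_imp_nonincreasing[of 0 1 \<phi>]) auto
  moreover have "\<phi> 1 - \<phi> 0 = u \<bullet> u - norm u * C * (norm h)\<^sup>2 / 2"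
  proof -
    have "gradient f (x + h) - hessian f x *v h = u + gradient f x"
      by (simp add: u_def h_def)
    then show ?thesis
      by (simp add: \<phi>_def inner_add_right)
  qed
  ultimately have "norm u * norm u \<le> norm u * (C / 2 * (norm h)\<^sup>2)"
    by (simp add: power2_norm_eq_inner flip: power2_eq_square)
  moreover have "0 \<le> C / 2 * (norm h)\<^sup>2"
    using lip by (simp add: hessian_lipschitz_def)
  ultimately have "norm u \<le> C / 2 * (norm h)\<^sup>2"
    \<comment> \<open>A factor \<open>norm u\<close> is cancelled; if it is zero, nonnegativity of
      the right side suffices.\<close>
    by (cases "norm u = 0") (simp_all add: mult_le_cancel_left)
  moreover have "gradient f x + hessian f x *v (y - x) - gradient f y = - u"
    by (simp add: u_def h_def)
  ultimately show ?thesis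
    by (simp add: h_def)
qed

section \<open>Gradient steps on smooth strongly convex functions\<close>

text \<open>A step of length \<open>1 / L\<close> along the negative gradient lowers the upper model
  by |g|^2 / (2L), which a minimizer forbids unless g = 0.\<close>

lemma gradient_eq_0_if_smooth_minimizer:
  assumes "smooth_fun L f" "0 < L" "\<And>y. f x \<le> f y"
  shows "gradient f x = 0"
proof -
  define g where "g = gradient f x"
  have "f x \<le> f (x - (1 / L) *\<^sub>R g)"
    by (rule assms(3))
  also have "\<dots> \<le> f x + g \<bullet> ((x - (1 / L) *\<^sub>R g) - x) + L / 2 * (norm ((x - (1 / L) *\<^sub>R g) - x))\<^sup>2"
    using assms(1) unfolding smooth_fun_def g_def by blast
  also have "\<dots> = f x - (g \<bullet> g) / (2 * L)"
    using assms(2) power2_norm_eq_inner[of g] by (simp add: power_divide field_simps power2_eq_square)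
  finally have "g \<bullet> g \<le> 0"
    using assms(2) by (simp add: field_simps)
  then show ?thesis
    by (metis antisym g_def inner_eq_zero_iff inner_ge_zero)
qed

text \<open>Cocoercivity of the gradient of \<open>f - \<mu>/2 \<parallel>\<cdot>\<parallel>\<^sup>2\<close>, rewritten in terms of \<open>f\<close>. It is obtained by
  comparing the lower model at one point with the upper model at the other, evaluated at
  \<open>z = x - t d\<close>; keeping the step \<open>t\<close> free covers the degenerate case \<open>L = \<mu>\<close>.\<close>

lemma strongly_convex_smooth_gradient:
  fixes f :: "'a::real_inner \<Rightarrow> real"
  assumes sc: "strongly_convex \<mu> f" and sm: "smooth_fun L f" and le: "\<mu> \<le> L"
  defines "G \<equiv> \<lambda>x y. gradient f x - gradient f y"
  shows "(norm (G x y))\<^sup>2 + \<mu> * L * (norm (x - y))\<^sup>2 \<le> (\<mu> + L) * (G x y \<bullet> (x - y))"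
proof -
  define d where "d = G x y - \<mu> *\<^sub>R (x - y)"
  \<comment> \<open>The strong convexity bound improved by a multiple of |e|^2, where
    \<open>e\<close> is the gradient difference of f - \<mu>/2 |.|^2 between \<open>a\<close> and
    \<open>b\<close>.\<close>
  have model: "f b + gradient f b \<bullet> (a - b) + \<mu> / 2 * (norm (a - b))\<^sup>2
      + (t - (L - \<mu>) * t\<^sup>2 / 2) * (e \<bullet> e) \<le> f a"
    if e: "e = G a b - \<mu> *\<^sub>R (a - b)" for a b e and t :: real
  proof -
    define w where "w = a - b"
    let ?z = "a - t *\<^sub>R e"
    have "f b + gradient f b \<bullet> (?z - b) + \<mu> / 2 * (norm (?z - b))\<^sup>2
        \<le> f a + gradient f a \<bullet> (?z - a) + L / 2 * (norm (?z - a))\<^sup>2"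
      using sc sm unfolding strongly_convex_def smooth_fun_def by (meson order_trans)
    moreover have "?z - b = w - t *\<^sub>R e" "?z - a = - (t *\<^sub>R e)"
      by (auto simp: w_def)
    moreover have "(norm (w - t *\<^sub>R e))\<^sup>2 = w \<bullet> w - 2 * t * (w \<bullet> e) + t\<^sup>2 * (e \<bullet> e)"
      unfolding power2_norm_eq_inner
      by (simp add: inner_diff_left inner_diff_right inner_commute algebra_simps power2_eq_square)
    moreover have "(norm (- (t *\<^sub>R e)))\<^sup>2 = t\<^sup>2 * (e \<bullet> e)"
      unfolding power2_norm_eq_inner by (simp add: power2_eq_square)
    moreover have "gradient f a = e + gradient f b + \<mu> *\<^sub>R w"
      by (simp add: e G_def w_def)
    ultimately have "f b + gradient f b \<bullet> (w - t *\<^sub>R e)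
          + \<mu> / 2 * (w \<bullet> w - 2 * t * (w \<bullet> e) + t\<^sup>2 * (e \<bullet> e))
        \<le> f a + (e + gradient f b + \<mu> *\<^sub>R w) \<bullet> (- (t *\<^sub>R e)) + L / 2 * (t\<^sup>2 * (e \<bullet> e))"
      by simp
    then have "f b + gradient f b \<bullet> w + \<mu> / 2 * (w \<bullet> w) + (t - (L - \<mu>) * t\<^sup>2 / 2) * (e \<bullet> e) \<le> f a"
      by (simp add: inner_diff_right inner_add_left field_simps)
    then show ?thesis
      by (simp add: w_def power2_norm_eq_inner)
  qed
  define w where "w = x - y"
  define g where "g = G x y"
  have d: "d = g - \<mu> *\<^sub>R w"
    by (simp add: d_def g_def w_def)
  have dw: "d \<bullet> w = g \<bullet> w - \<mu> * (w \<bullet> w)"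
    by (simp add: d inner_diff_left)
  \<comment> \<open>The improved bounds for (x, y) and (y, x) are added: exchanging the points only
    flips the sign of \<open>d\<close>, and the function values cancel.\<close>
  have *: "(2 * t - (L - \<mu>) * t\<^sup>2) * (d \<bullet> d) \<le> d \<bullet> w" for t
  proof -
    define q where "q = (t - (L - \<mu>) * t\<^sup>2 / 2) * (d \<bullet> d)"
    have "f y + gradient f y \<bullet> w + \<mu> / 2 * (w \<bullet> w) + q \<le> f x"
      using model[OF d_def, of t] by (simp add: w_def q_def power2_norm_eq_inner)
    moreover have "f x - gradient f x \<bullet> w + \<mu> / 2 * (w \<bullet> w) + q \<le> f y"
    proof -
      have "- d = G y x - \<mu> *\<^sub>R (y - x)"
        by (simp add: d_def G_def algebra_simps)
      from model[OF this, of t] have "f x + gradient f x \<bullet> (- w) + \<mu> / 2 * (norm (- w))\<^sup>2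
          + (t - (L - \<mu>) * t\<^sup>2 / 2) * (- d \<bullet> - d) \<le> f y"
        by (simp only: w_def minus_diff_eq)
      then show ?thesis
        by (simp add: q_def power2_norm_eq_inner)
    qed
    moreover have "g \<bullet> w = gradient f x \<bullet> w - gradient f y \<bullet> w"
      by (simp add: g_def G_def inner_diff_left)
    ultimately have "2 * q \<le> d \<bullet> w"
      unfolding dw by simp
    moreover have "2 * q = (2 * t - (L - \<mu>) * t\<^sup>2) * (d \<bullet> d)"
      by (simp add: q_def field_simps)
    ultimately show ?thesis
      by simp
  qed
  have "d \<bullet> d \<le> (L - \<mu>) * (d \<bullet> w)"
  proof (cases "L = \<mu>")
    case True
    \<comment> \<open>Here the left side of \<open>*\<close> is linear in \<open>t\<close>, hence
      unbounded unless \<open>d\<close> vanishes; the chosen \<open>t\<close> makes it exceed the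
      right side by 1.\<close>
    have "d \<bullet> d = 0"
    proof (rule ccontr)
      assume "d \<bullet> d \<noteq> 0"
      then have "2 * ((d \<bullet> w + 1) / (2 * (d \<bullet> d))) * (d \<bullet> d) = d \<bullet> w + 1"
        by simp
      then show False
        using *[of "(d \<bullet> w + 1) / (2 * (d \<bullet> d))"] True by simp
    qed
    then show ?thesis
      using True by simp
  next
    case False
    then have M: "0 < L - \<mu>"
      using le by simp
    \<comment> \<open>The value \<open>t = 1 / (L - \<mu>)\<close> maximizes the quadratic
      coefficient in \<open>*\<close>.\<close>
    then have "2 * (1 / (L - \<mu>)) - (L - \<mu>) * (1 / (L - \<mu>))\<^sup>2 = 1 / (L - \<mu>)"
      by (simp add: power2_eq_square)
    then have "1 / (L - \<mu>) * (d \<bullet> d) \<le> d \<bullet> w"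
      using *[of "1 / (L - \<mu>)"] by metis
    then show ?thesis
      using M by (simp add: divide_le_eq mult.commute)
  qed
  moreover have "d \<bullet> d = g \<bullet> g - 2 * \<mu> * (g \<bullet> w) + \<mu> * \<mu> * (w \<bullet> w)"
    unfolding d by (simp add: inner_diff_left inner_diff_right inner_commute[of w g] algebra_simps)
  moreover have "(L - \<mu>) * (d \<bullet> w)
      = L * (g \<bullet> w) - \<mu> * (g \<bullet> w) - \<mu> * L * (w \<bullet> w) + \<mu> * \<mu> * (w \<bullet> w)"
    unfolding dw by (simp add: algebra_simps)
  ultimately have "g \<bullet> g + \<mu> * L * (w \<bullet> w) \<le> (\<mu> + L) * (g \<bullet> w)"
    by (simp add: distrib_right)
  then show ?thesis
    by (simp add: g_def w_def power2_norm_eq_inner)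
qed

text \<open>With a the gradient norm and r the distance to \<open>y\<close>, the previous inequality
  and Cauchy-Schwarz give (a - L r)(a - \<mu> r) \<le> 0. Since \<mu> r \<le> L r, a cannot exceed L
  r.\<close>

lemma norm_gradient_le:
  fixes f :: "'a::real_inner \<Rightarrow> real"
  assumes "strongly_convex \<mu> f" "smooth_fun L f" "\<mu> \<le> L" "gradient f y = 0" "0 \<le> \<mu> + L"
  shows "norm (gradient f x) \<le> L * norm (x - y)"
proof (rule ccontr)
  assume neg: "\<not> ?thesis"
  have "\<mu> * norm (x - y) \<le> L * norm (x - y)"
    using assms(3) by (rule mult_right_mono) simp
  with neg have "0 < (norm (gradient f x) - L * norm (x - y)) * (norm (gradient f x) - \<mu> * norm (x - y))"
    by (intro mult_pos_pos) auto
  moreover have "(norm (gradient f x))\<^sup>2 + \<mu> * L * (norm (x - y))\<^sup>2 \<le> (\<mu> + L) * (gradient f x \<bullet> (x - y))"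
    using strongly_convex_smooth_gradient[OF assms(1-3), of x y] assms(4) by simp
  moreover have "0 \<le> \<mu> + L"
    using assms(5) by simp
  then have "(\<mu> + L) * (gradient f x \<bullet> (x - y)) \<le> (\<mu> + L) * (norm (gradient f x) * norm (x - y))"
    by (intro mult_left_mono norm_cauchy_schwarz)
  ultimately show False
    by (simp add: algebra_simps power2_eq_square)
qed

text \<open>After expanding the square, the inner product pays twice: its gradient term absorbs
  \<gamma>^2 |g|^2 because \<gamma> \<le> 2/(\<mu> + L), and its distance term yields the
  contraction.\<close>

lemma gradient_step_contraction:
  fixes f :: "'a::real_inner \<Rightarrow> real"
  assumes "strongly_convex \<mu> f" "smooth_fun L f" "\<mu> \<le> L" "gradient f y = 0"
    and "0 < \<mu> + L" "0 \<le> \<gamma>" "\<gamma> \<le> 2 / (\<mu> + L)"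
  shows "(norm (x - \<gamma> *\<^sub>R gradient f x - y))\<^sup>2 \<le> (1 - 2 * \<gamma> * (\<mu> * L / (L + \<mu>))) * (norm (x - y))\<^sup>2"
proof -
  let ?g = "gradient f x"
  have "(norm ?g)\<^sup>2 + \<mu> * L * (norm (x - y))\<^sup>2 \<le> (\<mu> + L) * (?g \<bullet> (x - y))"
    using strongly_convex_smooth_gradient[OF assms(1-3), of x y] assms(4) by simp
  then have "((norm ?g)\<^sup>2 + \<mu> * L * (norm (x - y))\<^sup>2) / (\<mu> + L) \<le> ?g \<bullet> (x - y)"
    using assms(5) by (simp add: field_simps)
  then have "2 * \<gamma> * (((norm ?g)\<^sup>2 + \<mu> * L * (norm (x - y))\<^sup>2) / (\<mu> + L)) \<le> 2 * \<gamma> * (?g \<bullet> (x - y))"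
    using assms(6) by (intro mult_left_mono) auto
  moreover have "\<gamma> * \<gamma> * (norm ?g)\<^sup>2 \<le> \<gamma> * (2 / (\<mu> + L)) * (norm ?g)\<^sup>2"
    using assms(6,7) by (intro mult_right_mono mult_left_mono) auto
  moreover have "(norm (x - \<gamma> *\<^sub>R ?g - y))\<^sup>2
      = (norm (x - y))\<^sup>2 - 2 * \<gamma> * (?g \<bullet> (x - y)) + \<gamma> * \<gamma> * (norm ?g)\<^sup>2"
  proof -
    have "(w - \<gamma> *\<^sub>R g) \<bullet> (w - \<gamma> *\<^sub>R g) = w \<bullet> w - 2 * \<gamma> * (g \<bullet> w) + \<gamma> * \<gamma> * (g \<bullet> g)" for w g :: 'a
      by (simp add: inner_diff_left inner_diff_right inner_commute[of w g] algebra_simps)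
    moreover have "x - \<gamma> *\<^sub>R ?g - y = (x - y) - \<gamma> *\<^sub>R ?g"
      by simp
    ultimately show ?thesis
      by (simp only: power2_norm_eq_inner)
  qed
  moreover have "2 * \<gamma> * (((norm ?g)\<^sup>2 + \<mu> * L * (norm (x - y))\<^sup>2) / (\<mu> + L))
      = \<gamma> * (2 / (\<mu> + L)) * (norm ?g)\<^sup>2 + 2 * \<gamma> * (\<mu> * L / (L + \<mu>)) * (norm (x - y))\<^sup>2"
    unfolding add.commute[of L \<mu>] by (simp add: add_divide_distrib distrib_left mult_ac)
  ultimately show ?thesis
    unfolding left_diff_distrib by simp
qed

section \<open>Sequences contracting with bounded delay\<close>

text \<open>A window holds N + 1 indices, so one factor \<delta> is gained per N + 1 steps; the
  exponent is (k - 1)/(N + 1) rounded up. Asking \<open>step\<close> only for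
  \<open>B \<le> V 1\<close> allows \<delta> to depend on the starting value.\<close>

lemma delayed_contraction:
  fixes V :: "nat \<Rightarrow> real"
  assumes \<delta>: "0 \<le> \<delta>" "\<delta> \<le> 1" and V1: "0 \<le> V 1"
    and step: "\<And>k B. 1 \<le> k \<Longrightarrow> 0 \<le> B \<Longrightarrow> B \<le> V 1 \<Longrightarrow>
      (\<And>l. 1 \<le> l \<Longrightarrow> l \<le> k \<Longrightarrow> k \<le> l + N \<Longrightarrow> V l \<le> B) \<Longrightarrow> V (k + 1) \<le> \<delta> * B"
    and "1 \<le> k"
  shows "V k \<le> \<delta> ^ ((k - 1 + N) div (N + 1)) * V 1"
  using \<open>1 \<le> k\<close>
proof (induction k rule: less_induct)
  case (less k)
  show ?case
  proof (cases "k = 1")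
    case False
    then obtain j where k: "k = j + 1" and j: "1 \<le> j"
      using less.prems by (metis One_nat_def Suc_eq_plus1 Suc_le_eq le_add_diff_inverse2 le_neq_implies_less zero_less_diff)
    \<comment> \<open>This is the induction bound at the oldest index j - N, the weakest one in the
      window.\<close>
    define B where "B = \<delta> ^ ((j - 1) div (N + 1)) * V 1"
    have "V l \<le> B" if "1 \<le> l" "l \<le> j" "j \<le> l + N" for l
    proof -
      have "V l \<le> \<delta> ^ ((l - 1 + N) div (N + 1)) * V 1"
        using less.IH that k by simp
      also have "\<dots> \<le> B"
        unfolding B_def using \<delta> V1 that
        by (intro mult_right_mono power_decreasing div_le_mono) auto
      finally show ?thesis .
    qed
    moreover have "0 \<le> B" "B \<le> V 1"
      using \<delta> V1 by (auto simp: B_def intro!: mult_left_le_one_le power_le_one)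
    ultimately have "V k \<le> \<delta> * B"
      unfolding k using step j by blast
    moreover have "(k - 1 + N) div (N + 1) = Suc ((j - 1) div (N + 1))"
    proof -
      have "k - 1 + N = (j - 1) + (N + 1)"
        using j k by simp
      then show ?thesis
        by (simp only: div_add_self2)
    qed
    ultimately show ?thesis
      by (simp add: B_def mult.assoc)
  qed simp
qed

text \<open>Passes from the \<open>div\<close> exponent, which suits induction, to the ceiling. For
  a base in [0, 1] the smaller exponent gives the weaker bound, so this direction is the useful
  one.\<close>

lemma ceiling_divide_le_div: "nat \<lceil>(real k - 1) / (real N + 1)\<rceil> \<le> (k - 1 + N) div (N + 1)"
proof -
  define q where "q = (k - 1 + N) div (N + 1)"
  have "k - 1 + N = q * (N + 1) + (k - 1 + N) mod (N + 1)"
    by (simp only: q_def div_mult_mod_eq)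
  moreover have "(k - 1 + N) mod (N + 1) < N + 1"
    by (rule mod_less_divisor) simp
  ultimately have "k \<le> q * (N + 1) + 1"
    by linarith
  then have "real k \<le> real (q * (N + 1) + 1)"
    by (rule of_nat_mono)
  then have "(real k - 1) / (real N + 1) \<le> real q"
    by (simp add: divide_le_eq algebra_simps)
  then show ?thesis
    unfolding q_def by (simp add: nat_le_iff ceiling_le_iff)
qed

text \<open>All factors of the majorant are at least \<open>\<rho>\<close>, so within the window it grows backwards by at
  most \<open>1 / \<rho> ^ N\<close>; this turns the delayed perturbation into an undelayed one.\<close>

lemma delayed_recursion_majorant:
  fixes V \<epsilon> :: "nat \<Rightarrow> real"
  assumes \<rho>: "0 < \<rho>" "\<rho> \<le> 1" and V: "\<And>k. 0 \<le> V k" and \<epsilon>: "\<And>k. 0 \<le> \<epsilon> k" "\<epsilon> \<longlonglongrightarrow> 0"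
    and step: "\<And>k B. 1 \<le> k \<Longrightarrow> 0 \<le> B \<Longrightarrow>
      (\<And>l. 1 \<le> l \<Longrightarrow> l \<le> k \<Longrightarrow> k \<le> l + N \<Longrightarrow> V l \<le> B) \<Longrightarrow> V (k + 1) \<le> \<rho> * V k + \<epsilon> k * B"
  shows "\<exists>Vbar. (\<forall>k\<ge>1. V k \<le> Vbar k) \<and> Vbar 1 = V 1 \<and> (\<forall>\<^sub>F k in sequentially. Vbar k \<noteq> 0) \<and>
    (\<lambda>k. Vbar (k + 1) / Vbar k) \<longlonglongrightarrow> \<rho>"
proof -
  \<comment> \<open>The factor \<open>1 / \<rho> ^ N\<close> is the price of comparing the oldest
    entry of a window with the newest.\<close>
  define r where "r k = \<rho> + \<epsilon> k / \<rho> ^ N" for k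
  define P where "P k = (\<Prod>j=1..<k. r j)" for k
  have r_ge: "\<rho> \<le> r k" for k
    using \<rho> \<epsilon>(1) by (simp add: r_def)
  then have r_pos: "0 < r k" for k
    using \<rho>(1) less_le_trans by blast
  have P_pos: "0 < P k" for k
    unfolding P_def by (intro prod_pos r_pos)
  have P_Suc: "P (k + 1) = r k * P k" if "1 \<le> k" for k
    unfolding P_def using that by simp
  have P_window: "\<rho> ^ n * P l \<le> P (l + n)" if "1 \<le> l" for l n
  proof (induction n)
    case (Suc n)
    have "\<rho> * (\<rho> ^ n * P l) \<le> r (l + n) * P (l + n)"
      using Suc r_ge \<rho> P_pos[of l] r_pos[of "l + n"] by (intro mult_mono) auto
    then show ?case
      using P_Suc[of "l + n"] that by (simp add: mult.assoc)
  qed simp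
  have V_le: "V k \<le> V 1 * P k" if "1 \<le> k" for k
    using that
  proof (induction k rule: less_induct)
    case (less k)
    show ?case
    proof (cases "k = 1")
      case False
      then obtain j where k: "k = j + 1" and j: "1 \<le> j"
        using less.prems by (metis One_nat_def Suc_eq_plus1 Suc_le_eq le_add_diff_inverse2 le_neq_implies_less zero_less_diff)
      have "V l \<le> V 1 * P j / \<rho> ^ N" if l: "1 \<le> l" "l \<le> j" "j \<le> l + N" for l
      proof -
        have "\<rho> ^ N * P l \<le> \<rho> ^ (j - l) * P l"
          using l \<rho> P_pos[of l] by (intro mult_right_mono power_decreasing) auto
        also have "\<dots> \<le> P j"
          using P_window[of l "j - l"] l by simp
        finally have "V 1 * P l \<le> V 1 * (P j / \<rho> ^ N)"
          using \<rho> V[of 1] by (intro mult_left_mono) (auto simp: field_simps)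
        then show ?thesis
          using less.IH[of l] l k by simp
      qed
      then have "V k \<le> \<rho> * V j + \<epsilon> j * (V 1 * P j / \<rho> ^ N)"
        unfolding k using j \<rho> V[of 1] P_pos[of j] by (intro step) auto
      also have "\<dots> \<le> \<rho> * (V 1 * P j) + \<epsilon> j * (V 1 * P j / \<rho> ^ N)"
        using less.IH[of j] j k \<rho> by simp
      also have "\<dots> = V 1 * P k"
        unfolding k P_Suc[OF j] r_def by (simp add: algebra_simps)
      finally show ?thesis .
    qed (simp add: P_def)
  qed
  have r_lim: "r \<longlonglongrightarrow> \<rho>"
    unfolding r_def using \<epsilon>(2) \<rho>(1) by (auto intro!: tendsto_eq_intros)
  show ?thesis
  proof (cases "V 1 = 0")
    case True
    \<comment> \<open>A majorant proportional to \<open>V 1\<close> would be identically zero and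
      have no meaningful ratios. Since \<open>V\<close> vanishes from index 1 on, a geometric
      sequence serves, set to 0 at index 1 only; the quotient at that index is a division by zero
      and does not affect the limit.\<close>
    define Vbar where "Vbar k = (if k = 1 then 0 else \<rho> ^ k)" for k
    have "V k \<le> Vbar k" if "1 \<le> k" for k
    proof -
      have "V k \<le> 0"
        using V_le[OF that] True by simp
      also have "0 \<le> Vbar k"
        using \<rho>(1) by (simp add: Vbar_def)
      finally show ?thesis .
    qed
    then have "\<forall>k\<ge>1. V k \<le> Vbar k"
      by blast
    moreover have "\<forall>\<^sub>F k in sequentially. Vbar k \<noteq> 0"
      using eventually_gt_at_top[of 1] by eventually_elim (use \<rho> in \<open>simp add: Vbar_def\<close>)
    moreover have "\<forall>\<^sub>F k in sequentially. Vbar (k + 1) / Vbar k = \<rho>"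
      using eventually_gt_at_top[of 1] by eventually_elim (use \<rho> in \<open>simp add: Vbar_def\<close>)
    moreover have "Vbar 1 = V 1"
      using True by (simp add: Vbar_def)
    ultimately show ?thesis
      by (intro exI[of _ Vbar] conjI tendsto_eventually)
  next
    case False
    have "\<forall>\<^sub>F k in sequentially. r k = (V 1 * P (k + 1)) / (V 1 * P k)"
      using eventually_ge_at_top[of 1]
    proof eventually_elim
      case (elim k)
      then show ?case
        using P_Suc[of k] P_pos[of k] False by simp
    qed
    then have "(\<lambda>k. (V 1 * P (k + 1)) / (V 1 * P k)) \<longlonglongrightarrow> \<rho>"
      by (rule Lim_transform_eventually[OF r_lim])
    moreover have "V 1 * P k \<noteq> 0" for k
      using False P_pos[of k] by simp
    moreover have "V 1 * P 1 = V 1"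
      by (simp add: P_def)
    ultimately show ?thesis
      using V_le by (intro exI[of _ "\<lambda>k. V 1 * P k"]) simp
  qed
qed

section \<open>The CIAG recursion\<close>

text \<open>This is \<open>\<epsilon>\<close> as a function of \<open>s = \<surd>V\<close>, so that no fractional powers occur.\<close>

definition ciag_perturbation :: "real \<Rightarrow> nat \<Rightarrow> real \<Rightarrow> real \<Rightarrow> real \<Rightarrow> real" where
  "ciag_perturbation \<gamma> K L LH s =
     2 * \<gamma> ^ 3 * LH * real K ^ 2 * (L ^ 2 * s + 4 * LH ^ 2 * s ^ 3) +
     2 * \<gamma> ^ 6 * LH ^ 2 * real K ^ 4 * (L ^ 4 * s ^ 2 + 16 * LH ^ 4 * s ^ 6)"

lemma ciag_perturbation_nonneg:
  assumes "0 \<le> \<gamma>" "0 \<le> LH" "0 \<le> s"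
  shows "0 \<le> ciag_perturbation \<gamma> K L LH s"
  unfolding ciag_perturbation_def using assms by (intro add_nonneg_nonneg mult_nonneg_nonneg) auto

lemma ciag_perturbation_mono:
  assumes "0 \<le> \<gamma>" "0 \<le> LH" "0 \<le> s" "s \<le> t"
  shows "ciag_perturbation \<gamma> K L LH s \<le> ciag_perturbation \<gamma> K L LH t"
  unfolding ciag_perturbation_def using assms
  by (intro add_mono mult_left_mono power_mono mult_nonneg_nonneg) auto

lemma last_access_bounds:
  assumes "1 \<le> k"
  shows "1 \<le> last_access idx i k" "last_access idx i k \<le> k"
proof -
  have "1 \<le> last_access idx i k \<and> last_access idx i k \<le> k"
  proof (cases "\<exists>t\<in>{1..k}. idx t = i")
    case True
    then have "Max {t \<in> {1..k}. idx t = i} \<in> {t \<in> {1..k}. idx t = i}"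
      by (intro Max_in) auto
    then show ?thesis
      using True by (simp add: last_access_def)
  qed (use assms in \<open>auto simp: last_access_def\<close>)
  then show "1 \<le> last_access idx i k" "last_access idx i k \<le> k"
    by auto
qed

lemma sum_power2_le: "(a + b)\<^sup>2 \<le> 2 * (a\<^sup>2 + b\<^sup>2)" for a b :: real
  using zero_le_power2[of "a - b"] by (simp add: power2_eq_square algebra_simps)

text \<open>In (|p| + \<gamma> E)^2 the cross term, with |p| \<le> s, produces the \<gamma>^3 part
  of \<open>ciag_perturbation\<close>, and the square of \<gamma> E the \<gamma>^6 part. Every error
  term carries a factor s^2.\<close>

lemma perturbed_contraction:
  fixes p e :: "'a::real_normed_vector"
  assumes p: "(norm p)\<^sup>2 \<le> \<rho> * v\<^sup>2" "\<rho> \<le> 1" "0 \<le> v" "v \<le> s" and nonneg: "0 \<le> \<gamma>" "0 \<le> LH"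
    and e: "norm e \<le> LH * \<gamma>\<^sup>2 * (real K)\<^sup>2 * (L\<^sup>2 * s\<^sup>2 + 4 * LH\<^sup>2 * s ^ 4)"
  shows "(norm (p - \<gamma> *\<^sub>R e))\<^sup>2 \<le> \<rho> * v\<^sup>2 + s\<^sup>2 * ciag_perturbation \<gamma> K L LH s"
proof -
  define a b where "a = L\<^sup>2 * s\<^sup>2" and "b = 4 * LH\<^sup>2 * s ^ 4"
  define E where "E = LH * \<gamma>\<^sup>2 * (real K)\<^sup>2 * (a + b)"
  have E: "norm e \<le> E" "0 \<le> E"
    using e nonneg by (auto simp: E_def a_def b_def)
  have "\<rho> * v\<^sup>2 \<le> 1 * s\<^sup>2"
    using p zero_le_power2[of v] by (intro order_trans[OF mult_right_mono[OF p(2)]]) (auto intro: power_mono)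
  then have "(norm p)\<^sup>2 \<le> s\<^sup>2"
    using p(1) by linarith
  moreover have "0 \<le> s"
    using p(3,4) by linarith
  ultimately have "norm p \<le> s"
    by (rule power2_le_imp_le)
  have "norm (p - \<gamma> *\<^sub>R e) \<le> norm p + \<gamma> * E"
    using norm_triangle_ineq4[of p "\<gamma> *\<^sub>R e"] mult_left_mono[OF E(1) nonneg(1)] nonneg by simp
  then have "(norm (p - \<gamma> *\<^sub>R e))\<^sup>2 \<le> (norm p + \<gamma> * E)\<^sup>2"
    by (intro power_mono) auto
  also have "\<dots> = (norm p)\<^sup>2 + norm p * (2 * \<gamma> * E) + (\<gamma> * E)\<^sup>2"
    by (simp add: power2_sum)
  also have "\<dots> \<le> \<rho> * v\<^sup>2 + s * (2 * \<gamma> * E) + (\<gamma> * E)\<^sup>2"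
    using p(1) \<open>norm p \<le> s\<close> nonneg E by (intro add_mono mult_right_mono) auto
  finally have "(norm (p - \<gamma> *\<^sub>R e))\<^sup>2 \<le> \<rho> * v\<^sup>2 + s * (2 * \<gamma> * E) + (\<gamma> * E)\<^sup>2" .
  moreover have "s * (2 * \<gamma> * E) = s\<^sup>2 * (2 * \<gamma> ^ 3 * LH * real K ^ 2 * (L ^ 2 * s + 4 * LH ^ 2 * s ^ 3))"
    unfolding E_def a_def b_def by algebra
  moreover have "(\<gamma> * E)\<^sup>2 \<le> s\<^sup>2 * (2 * \<gamma> ^ 6 * LH ^ 2 * real K ^ 4 * (L ^ 4 * s ^ 2 + 16 * LH ^ 4 * s ^ 6))"
  proof -
    \<comment> \<open>Squaring \<open>b\<close> turns the 4 into the 16 of the \<gamma>^6 part, and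
      this inequality supplies its leading 2.\<close>
    have "(a + b)\<^sup>2 \<le> 2 * (a\<^sup>2 + b\<^sup>2)"
      by (rule sum_power2_le)
    then have "(\<gamma> * (LH * \<gamma>\<^sup>2 * (real K)\<^sup>2))\<^sup>2 * (a + b)\<^sup>2
        \<le> (\<gamma> * (LH * \<gamma>\<^sup>2 * (real K)\<^sup>2))\<^sup>2 * (2 * (a\<^sup>2 + b\<^sup>2))"
      by (rule mult_left_mono) simp
    moreover have "(\<gamma> * E)\<^sup>2 = (\<gamma> * (LH * \<gamma>\<^sup>2 * (real K)\<^sup>2))\<^sup>2 * (a + b)\<^sup>2"
      unfolding E_def by algebra
    moreover have "(\<gamma> * (LH * \<gamma>\<^sup>2 * (real K)\<^sup>2))\<^sup>2 * (2 * (a\<^sup>2 + b\<^sup>2))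
        = s\<^sup>2 * (2 * \<gamma> ^ 6 * LH ^ 2 * real K ^ 4 * (L ^ 4 * s ^ 2 + 16 * LH ^ 4 * s ^ 6))"
      unfolding a_def b_def by algebra
    ultimately show ?thesis
      by simp
  qed
  ultimately show ?thesis
    unfolding ciag_perturbation_def distrib_left[of "s\<^sup>2"] by linarith
qed

text \<open>Only 0 \<le> \<gamma> \<le> 2/(\<mu> + L) is imposed, which is what the gradient step
  needs; the finer step size condition enters when the perturbation is compared with the contraction
  gap. The delay bound is additive to avoid truncated subtraction.\<close>

locale ciag_run =
  fixes m K :: nat
    and f :: "nat \<Rightarrow> real^'d \<Rightarrow> real"
    and F :: "real^'d \<Rightarrow> real"
    and idx :: "nat \<Rightarrow> nat"
    and \<theta> :: "nat \<Rightarrow> real^'d"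
    and \<theta>star :: "real^'d"
    and LHi :: "nat \<Rightarrow> real"
    and LH \<mu> L \<gamma> :: real
  assumes C2: "\<And>i. i \<in> {1..m} \<Longrightarrow> twice_continuously_differentiable (f i)"
    and F: "F = (\<lambda>x. \<Sum>i=1..m. f i x)"
    and delay: "\<And>i k. i \<in> {1..m} \<Longrightarrow> 1 \<le> k \<Longrightarrow> k \<le> last_access idx i k + K"
    and strongly_convex: "strongly_convex \<mu> F"
    and smooth: "smooth_fun L F"
    and const: "0 < \<mu>" "\<mu> \<le> L"
    and hess_Lipschitz: "\<And>i. i \<in> {1..m} \<Longrightarrow> hessian_lipschitz (LHi i) (f i)"
    and LH: "LH = (\<Sum>i=1..m. LHi i)"
    and stepsize: "0 \<le> \<gamma>" "\<gamma> \<le> 2 / (\<mu> + L)"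
    and step: "\<And>k. 1 \<le> k \<Longrightarrow> \<theta> (k + 1) = \<theta> k - \<gamma> *\<^sub>R ciag_direction m f idx \<theta> k"
    and minimizer: "\<And>x. F \<theta>star \<le> F x"
begin

section \<open>Error bounds and the one-step estimate along a run\<close>

lemma LHi_nonneg: "i \<in> {1..m} \<Longrightarrow> 0 \<le> LHi i"
  using hess_Lipschitz by (simp add: hessian_lipschitz_def)

lemma LH_nonneg: "0 \<le> LH"
  unfolding LH by (intro sum_nonneg LHi_nonneg)

lemma gradient_star: "gradient F \<theta>star = 0"
  using const minimizer by (intro gradient_eq_0_if_smooth_minimizer[OF smooth]) auto

definition err :: "nat \<Rightarrow> real^'d" where
  "err k = ciag_direction m f idx \<theta> k - gradient F (\<theta> k)"

text \<open>The error is the sum of the Taylor remainders of the components, and their Lipschitz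
  constants add up to \<open>LH\<close>.\<close>

lemma norm_err_le:
  assumes "1 \<le> k" and R: "\<And>i. i \<in> {1..m} \<Longrightarrow> norm (\<theta> k - \<theta> (last_access idx i k)) \<le> R"
  shows "norm (err k) \<le> LH / 2 * R\<^sup>2"
proof -
  let ?x = "\<lambda>i. \<theta> (last_access idx i k)"
  have "gradient F (\<theta> k) = (\<Sum>i=1..m. gradient (f i) (\<theta> k))"
    unfolding F using C2 by (intro gradient_sum) (auto simp: twice_continuously_differentiable_def)
  then have "err k = (\<Sum>i=1..m. gradient (f i) (?x i) + hessian (f i) (?x i) *v (\<theta> k - ?x i)
      - gradient (f i) (\<theta> k))"
    by (simp add: err_def ciag_direction_def sum_subtractf)
  also have "norm \<dots> \<le> (\<Sum>i=1..m. LHi i / 2 * R\<^sup>2)"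
  proof (rule sum_norm_le)
    fix i assume i: "i \<in> {1..m}"
    have "norm (gradient (f i) (?x i) + hessian (f i) (?x i) *v (\<theta> k - ?x i) - gradient (f i) (\<theta> k))
        \<le> LHi i / 2 * (norm (\<theta> k - ?x i))\<^sup>2"
      using i by (intro gradient_taylor_bound C2 hess_Lipschitz)
    also have "\<dots> \<le> LHi i / 2 * R\<^sup>2"
      using LHi_nonneg[OF i] R[OF i] by (intro mult_left_mono power_mono) auto
    finally show "norm (gradient (f i) (?x i) + hessian (f i) (?x i) *v (\<theta> k - ?x i)
        - gradient (f i) (\<theta> k)) \<le> LHi i / 2 * R\<^sup>2" .
  qed
  also have "\<dots> = LH / 2 * R\<^sup>2"
    by (simp add: LH sum_divide_distrib sum_distrib_right)
  finally show ?thesis .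
qed

text \<open>A crude bound suffices here: points within \<open>s\<close> of the minimizer are within
  \<open>2 * s\<close> of each other, whence the term 2 LH s^2.\<close>

lemma norm_direction_le:
  assumes "1 \<le> k" and s: "\<And>l. 1 \<le> l \<Longrightarrow> l \<le> k \<Longrightarrow> k \<le> l + K \<Longrightarrow> norm (\<theta> l - \<theta>star) \<le> s"
  shows "norm (ciag_direction m f idx \<theta> k) \<le> L * s + 2 * LH * s\<^sup>2"
proof -
  have k: "norm (\<theta> k - \<theta>star) \<le> s"
    using assms by simp
  have "norm (\<theta> k - \<theta> (last_access idx i k)) \<le> 2 * s" if "i \<in> {1..m}" for i
    using norm_triangle_ineq4[of "\<theta> k - \<theta>star" "\<theta> (last_access idx i k) - \<theta>star"] k
      s[OF last_access_bounds[OF \<open>1 \<le> k\<close>] delay[OF that \<open>1 \<le> k\<close>]] by simp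
  then have "norm (err k) \<le> LH / 2 * (2 * s)\<^sup>2"
    using \<open>1 \<le> k\<close> by (intro norm_err_le)
  moreover have "norm (gradient F (\<theta> k)) \<le> L * s"
    using const mult_left_mono[OF k, of L]
    by (intro order_trans[OF norm_gradient_le[OF strongly_convex smooth const(2) gradient_star]]) auto
  moreover have "ciag_direction m f idx \<theta> k = gradient F (\<theta> k) + err k"
    by (simp add: err_def)
  ultimately show ?thesis
    using norm_triangle_ineq[of "gradient F (\<theta> k)" "err k"] by (simp add: power_mult_distrib)
qed

lemma norm_iterate_diff_le:
  assumes "1 \<le> j" and "\<And>l. j \<le> l \<Longrightarrow> l < j + n \<Longrightarrow> norm (ciag_direction m f idx \<theta> l) \<le> D"
  shows "norm (\<theta> (j + n) - \<theta> j) \<le> real n * (\<gamma> * D)"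
  using assms(2)
proof (induction n)
  case (Suc n)
  have eq: "\<theta> (j + Suc n) - \<theta> j = (\<theta> (j + n) - \<theta> j) - \<gamma> *\<^sub>R ciag_direction m f idx \<theta> (j + n)"
    using step[of "j + n"] assms(1) by simp
  have "norm (\<theta> (j + Suc n) - \<theta> j)
      \<le> norm (\<theta> (j + n) - \<theta> j) + \<gamma> * norm (ciag_direction m f idx \<theta> (j + n))"
    unfolding eq using norm_triangle_ineq4[of "\<theta> (j + n) - \<theta> j" "\<gamma> *\<^sub>R ciag_direction m f idx \<theta> (j + n)"] stepsize(1)
    by simp
  also have "\<dots> \<le> real n * (\<gamma> * D) + \<gamma> * D"
  proof (intro add_mono mult_left_mono)
    show "norm (\<theta> (j + n) - \<theta> j) \<le> real n * (\<gamma> * D)"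
      using Suc.prems by (intro Suc.IH) simp
    show "norm (ciag_direction m f idx \<theta> (j + n)) \<le> D"
      using Suc.prems by simp
  qed (fact stepsize(1))
  also have "\<dots> = real (Suc n) * (\<gamma> * D)"
    by (simp add: distrib_right)
  finally show ?case .
qed simp

text \<open>The delayed iterates lie at most K steps back, and the directions that moved them look
  back K further, hence the window 2K. The movement is at most K \<gamma> times the crude direction
  bound, and the error is quadratic in it.\<close>

lemma norm_err_window:
  assumes "1 \<le> k" and s: "\<And>l. 1 \<le> l \<Longrightarrow> l \<le> k \<Longrightarrow> k \<le> l + 2 * K \<Longrightarrow> norm (\<theta> l - \<theta>star) \<le> s"
  shows "norm (err k) \<le> LH * \<gamma>\<^sup>2 * (real K)\<^sup>2 * (L\<^sup>2 * s\<^sup>2 + 4 * LH\<^sup>2 * s ^ 4)"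
proof -
  define D where "D = L * s + 2 * LH * s\<^sup>2"
  have "norm (\<theta> k - \<theta>star) \<le> s"
    using \<open>1 \<le> k\<close> by (intro s) auto
  then have "0 \<le> s"
    by (rule order_trans[OF norm_ge_zero])
  then have "0 \<le> D"
    using const LH_nonneg by (simp add: D_def)
  have "norm (\<theta> k - \<theta> (last_access idx i k)) \<le> real K * (\<gamma> * D)" if "i \<in> {1..m}" for i
  proof -
    define j where "j = last_access idx i k"
    have j: "1 \<le> j" "j \<le> k" "k \<le> j + K"
      using last_access_bounds[OF \<open>1 \<le> k\<close>] delay[OF that \<open>1 \<le> k\<close>] by (auto simp: j_def)
    have "norm (ciag_direction m f idx \<theta> l) \<le> D" if "j \<le> l" "l < j + (k - j)" for l
      unfolding D_def using that j s by (intro norm_direction_le) auto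
    then have "norm (\<theta> (j + (k - j)) - \<theta> j) \<le> real (k - j) * (\<gamma> * D)"
      using j by (intro norm_iterate_diff_le) auto
    also have "\<dots> \<le> real K * (\<gamma> * D)"
      using j stepsize(1) \<open>0 \<le> D\<close> by (intro mult_right_mono) auto
    finally show ?thesis
      using j by (simp add: j_def)
  qed
  then have "norm (err k) \<le> LH / 2 * (real K * (\<gamma> * D))\<^sup>2"
    using \<open>1 \<le> k\<close> by (intro norm_err_le)
  also have "\<dots> = LH / 2 * (real K)\<^sup>2 * \<gamma>\<^sup>2 * D\<^sup>2"
    by (simp add: power_mult_distrib)
  also have "D\<^sup>2 \<le> 2 * ((L * s)\<^sup>2 + (2 * LH * s\<^sup>2)\<^sup>2)"
    using sum_power2_le[of "L * s" "2 * LH * s\<^sup>2"] by (simp add: D_def)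
  then have "LH / 2 * (real K)\<^sup>2 * \<gamma>\<^sup>2 * D\<^sup>2
      \<le> LH / 2 * (real K)\<^sup>2 * \<gamma>\<^sup>2 * (2 * ((L * s)\<^sup>2 + (2 * LH * s\<^sup>2)\<^sup>2))"
    using LH_nonneg by (intro mult_left_mono) auto
  also have "\<dots> = LH * \<gamma>\<^sup>2 * (real K)\<^sup>2 * (L\<^sup>2 * s\<^sup>2 + 4 * LH\<^sup>2 * s ^ 4)"
    by (simp add: power_mult_distrib algebra_simps)
  finally show ?thesis .
qed

definition rate :: real where
  "rate = 1 - 2 * \<gamma> * (\<mu> * L / (L + \<mu>))"

lemma rate_le_1: "rate \<le> 1"
  using const stepsize(1) by (simp add: rate_def)

text \<open>Two bounds on the same window are kept apart: \<open>s\<close> sets the size of the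
  coefficient, \<open>B\<close> is the quantity it multiplies. The coefficient can then be fixed in
  advance or tend to 0 while \<open>B\<close> stays free.\<close>

lemma step_bound:
  assumes k: "1 \<le> k" and s: "0 \<le> s" and B: "0 \<le> B"
    and window: "\<And>l. 1 \<le> l \<Longrightarrow> l \<le> k \<Longrightarrow> k \<le> l + 2 * K \<Longrightarrow>
      norm (\<theta> l - \<theta>star) \<le> s \<and> (norm (\<theta> l - \<theta>star))\<^sup>2 \<le> B"
  shows "(norm (\<theta> (k + 1) - \<theta>star))\<^sup>2
    \<le> rate * (norm (\<theta> k - \<theta>star))\<^sup>2 + ciag_perturbation \<gamma> K L LH s * B"
proof -
  \<comment> \<open>The error estimate is applied at the smaller radius; monotonicity then trades
    t^2 for \<open>B\<close> and the coefficient at \<open>t\<close> for that at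
    \<open>s\<close>.\<close>
  define t where "t = min s (sqrt B)"
  have t: "0 \<le> t" "t \<le> s"
    using s B by (auto simp: t_def)
  have "t\<^sup>2 \<le> (sqrt B)\<^sup>2"
    using t by (intro power_mono) (auto simp: t_def)
  then have t_sq: "t\<^sup>2 \<le> B"
    using B by simp
  have in_t: "norm (\<theta> l - \<theta>star) \<le> t" if "1 \<le> l" "l \<le> k" "k \<le> l + 2 * K" for l
    using window[OF that] by (simp add: t_def real_le_rsqrt)
  have "(norm (\<theta> k - \<gamma> *\<^sub>R gradient F (\<theta> k) - \<theta>star))\<^sup>2 \<le> rate * (norm (\<theta> k - \<theta>star))\<^sup>2"
    unfolding rate_def using strongly_convex smooth const gradient_star stepsize
    by (intro gradient_step_contraction) auto
  then have "(norm (\<theta> k - \<gamma> *\<^sub>R gradient F (\<theta> k) - \<theta>star - \<gamma> *\<^sub>R err k))\<^sup>2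
      \<le> rate * (norm (\<theta> k - \<theta>star))\<^sup>2 + t\<^sup>2 * ciag_perturbation \<gamma> K L LH t"
    using in_t k by (intro perturbed_contraction norm_err_window rate_le_1 stepsize LH_nonneg) auto
  also have "\<theta> k - \<gamma> *\<^sub>R gradient F (\<theta> k) - \<theta>star - \<gamma> *\<^sub>R err k = \<theta> (k + 1) - \<theta>star"
    unfolding step[OF k] err_def by (simp add: algebra_simps)
  also have "t\<^sup>2 * ciag_perturbation \<gamma> K L LH t \<le> B * ciag_perturbation \<gamma> K L LH s"
    using t t_sq s B stepsize(1) LH_nonneg
    by (intro mult_mono ciag_perturbation_mono ciag_perturbation_nonneg) auto
  finally show ?thesis
    by (simp add: mult.commute)
qed

end

section \<open>Step size condition and size of the contraction gap\<close>

lemma ciag_perturbation_less: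
  assumes const: "0 < \<mu>" "\<mu> \<le> L" and "0 \<le> LH" "0 \<le> s" "0 < c" and \<gamma>: "\<gamma> = c / (\<mu> + L)"
    and b2: "ereal c < step_bound_2 K \<mu> L LH (s\<^sup>2)" and b3: "ereal c < step_bound_3 K \<mu> L LH (s\<^sup>2)"
  shows "ciag_perturbation \<gamma> K L LH s < 2 * \<gamma> * (\<mu> * L / (L + \<mu>))"
proof -
  \<comment> \<open>These are the denominators of the two step size bounds at V = s^2. Each bound
    pays for one half of the gap: the second for the \<gamma>^3 part, the third for the \<gamma>^6
    part.\<close>
  define D2 where "D2 = 2 * LH * (L ^ 2 * s + 4 * LH ^ 2 * s ^ 3)"
  define D3 where "D3 = 2 * LH ^ 2 * (L ^ 4 * s ^ 2 + 16 * LH ^ 4 * s ^ 6)"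
  define M where "M = \<mu> + L"
  have M: "\<mu> + L = M" "L + \<mu> = M"
    by (simp_all add: M_def)
  have pos: "0 < \<mu> + L" "0 < M" "0 < \<mu> * L" "0 < \<gamma>"
    using const \<open>0 < c\<close> by (simp_all add: \<gamma> M_def)
  have D: "0 \<le> D2" "0 \<le> D3"
    unfolding D2_def D3_def using const(1) \<open>0 \<le> LH\<close> \<open>0 \<le> s\<close>
    by (intro mult_nonneg_nonneg add_nonneg_nonneg; simp)+
  have powr_half: "(s\<^sup>2) powr (1/2) = s"
    using \<open>0 \<le> s\<close> by (simp add: powr_half_sqrt)
  have powr_3_half: "(s\<^sup>2) powr (3/2) = s ^ 3"
  proof (cases "s = 0")
    case False
    then show ?thesis
      using \<open>0 \<le> s\<close> powr_powr[of s 2 "3/2"] by simp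
  qed simp
  have "real K ^ 2 * D2 * c ^ 2 < \<mu> * L * (\<mu> + L)"
  \<comment> \<open>When the bound reads as infinity, the left side is 0 and the right side
    positive.\<close>
  proof (cases "K = 0 \<or> D2 = 0")
    case False
    then have D2_pos: "0 < D2" and K_pos: "0 < real K"
      using D by auto
    have "c < 1 / real K * sqrt (\<mu> * L * (\<mu> + L) / D2)"
      using b2 False unfolding step_bound_2_def powr_half powr_3_half D2_def[symmetric] Let_def
      by simp
    then have "c * real K < sqrt (\<mu> * L * (\<mu> + L) / D2)"
      using K_pos by (simp add: field_simps)
    then have "(c * real K)\<^sup>2 < (sqrt (\<mu> * L * (\<mu> + L) / D2))\<^sup>2"
      using \<open>0 < c\<close> by (intro power_strict_mono) auto
    also have "\<dots> = \<mu> * L * (\<mu> + L) / D2"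
      using pos D2_pos by simp
    finally show ?thesis
      using D2_pos by (simp add: field_simps power_mult_distrib)
  qed (use pos in auto)
  \<comment> \<open>The factor \<open>c / M ^ 3\<close> turns c^3 into \<gamma>^3 on the left and
    leaves half of the gap on the right.\<close>
  then have "real K ^ 2 * D2 * c ^ 2 * (c / M ^ 3) < \<mu> * L * M * (c / M ^ 3)"
    unfolding M using pos \<open>0 < c\<close> by (intro mult_strict_right_mono) auto
  also have "\<dots> = \<gamma> * (\<mu> * L / (L + \<mu>))"
    using pos unfolding \<gamma> M by (simp add: field_simps power3_eq_cube)
  also have "real K ^ 2 * D2 * c ^ 2 * (c / M ^ 3) = real K ^ 2 * D2 * \<gamma> ^ 3"
    unfolding \<gamma> M by (simp add: power_divide power2_eq_square power3_eq_cube)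
  finally have 2: "real K ^ 2 * D2 * \<gamma> ^ 3 < \<gamma> * (\<mu> * L / (L + \<mu>))" .
  have "real K ^ 4 * D3 * c ^ 5 < \<mu> * L * (\<mu> + L) ^ 4"
  proof (cases "K = 0 \<or> D3 = 0")
    case False
    then have D3_pos: "0 < D3" and K_pos: "0 < real K"
      using D by auto
    have "s\<^sup>2 ^ 3 = s ^ 6"
      by (simp flip: power_mult)
    then have "c < (1 / real K ^ 4 * (\<mu> * L * (\<mu> + L) ^ 4 / D3)) powr (1/5)"
      using b3 False unfolding step_bound_3_def D3_def Let_def by simp
    then have "c ^ 5 < ((1 / real K ^ 4 * (\<mu> * L * (\<mu> + L) ^ 4 / D3)) powr (1/5)) ^ 5"
      using \<open>0 < c\<close> by (intro power_strict_mono) auto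
    also have "\<dots> = 1 / real K ^ 4 * (\<mu> * L * (\<mu> + L) ^ 4 / D3)"
      using pos D3_pos K_pos by (subst powr_realpow[symmetric]) (auto simp: powr_powr)
    finally show ?thesis
      using D3_pos K_pos by (simp add: field_simps)
  qed (use pos in auto)
  then have "real K ^ 4 * D3 * c ^ 5 * (c / M ^ 6) < \<mu> * L * M ^ 4 * (c / M ^ 6)"
    unfolding M using pos \<open>0 < c\<close> by (intro mult_strict_right_mono) auto
  also have "\<dots> = \<gamma> * (\<mu> * L / (L + \<mu>))"
  proof -
    have "M ^ 6 = M ^ 4 * (M * M)"
      by algebra
    then show ?thesis
      using pos unfolding \<gamma> M by simp
  qed
  also have "real K ^ 4 * D3 * c ^ 5 * (c / M ^ 6) = real K ^ 4 * D3 * \<gamma> ^ 6"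
  proof -
    have "c ^ 6 = c ^ 5 * c"
      by algebra
    then show ?thesis
      unfolding \<gamma> M by (simp add: power_divide)
  qed
  finally have 3: "real K ^ 4 * D3 * \<gamma> ^ 6 < \<gamma> * (\<mu> * L / (L + \<mu>))" .
  have "ciag_perturbation \<gamma> K L LH s = real K ^ 2 * D2 * \<gamma> ^ 3 + real K ^ 4 * D3 * \<gamma> ^ 6"
    unfolding ciag_perturbation_def D2_def D3_def by (simp add: algebra_simps)
  moreover have "2 * \<gamma> * (\<mu> * L / (L + \<mu>)) = \<gamma> * (\<mu> * L / (L + \<mu>)) + \<gamma> * (\<mu> * L / (L + \<mu>))"
    by simp
  ultimately show ?thesis
    using add_strict_mono[OF 2 3] by metis
qed

text \<open>The constant 2 works because (\<mu> + L)^2 \<ge> L^2. The principal filter makes the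
  bound uniform over all admissible parameters instead of a statement about a limit.\<close>

lemma contraction_gap_bigo:
  "(\<lambda>(c::real, \<mu>::real, L::real). 2 * (c / (\<mu> + L)) * (\<mu> * L / (L + \<mu>)))
     \<in> O[principal {(c, \<mu>, L). 0 < c \<and> 0 < \<mu> \<and> \<mu> \<le> L}](\<lambda>(c, \<mu>, L). c / (L / \<mu>))"
proof (rule bigoI[of _ 2])
  have "2 * (c / (\<mu> + L)) * (\<mu> * L / (L + \<mu>)) \<le> 2 * (c / (L / \<mu>))"
    if "0 < c" "0 < \<mu>" "\<mu> \<le> L" for c \<mu> L :: real
  proof -
    have "L * L \<le> (\<mu> + L) * (\<mu> + L)"
      using that by (intro mult_mono) auto
    then have "2 * c * \<mu> * L / ((\<mu> + L) * (\<mu> + L)) \<le> 2 * c * \<mu> * L / (L * L)"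
      using that by (intro divide_left_mono) auto
    then show ?thesis
      using that by (simp add: add.commute mult.assoc)
  qed
  then show "\<forall>\<^sub>F x in principal {(c::real, \<mu>::real, L::real). 0 < c \<and> 0 < \<mu> \<and> \<mu> \<le> L}.
      norm (case x of (c, \<mu>, L) \<Rightarrow> 2 * (c / (\<mu> + L)) * (\<mu> * L / (L + \<mu>)))
        \<le> 2 * norm (case x of (c, \<mu>, L) \<Rightarrow> c / (L / \<mu>))"
    by (auto simp: eventually_principal)
qed

section \<open>Linear convergence and the asymptotic ratio\<close>

theorem theorem1:
  fixes m K :: nat
    and f :: "nat \<Rightarrow> real^'d \<Rightarrow> real"
    and F :: "real^'d \<Rightarrow> real"
    and idx :: "nat \<Rightarrow> nat"
    and \<theta> :: "nat \<Rightarrow> real^'d"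
    and \<theta>star :: "real^'d"
    and LHi :: "nat \<Rightarrow> real"
    and LH \<mu> L c \<gamma> :: real
    and V :: "nat \<Rightarrow> real"
  assumes C2: "\<forall>i\<in>{1..m}. twice_continuously_differentiable (f i)"
    and F: "F = (\<lambda>x. \<Sum>i=1..m. f i x)"
    and delay: "\<forall>i\<in>{1..m}. \<forall>k\<ge>1. int k - int (last_access idx i k) \<in> {0..int K}"
    and strongly_convex: "strongly_convex \<mu> F"
    and smooth: "smooth_fun L F"
    and const: "0 < \<mu>" "\<mu> \<le> L"
    and hess_Lipschitz: "\<forall>i\<in>{1..m}. hessian_lipschitz (LHi i) (f i)"
    and LH: "LH = (\<Sum>i=1..m. LHi i)"
    and c_pos: "0 < c"
    and \<gamma>: "\<gamma> = c / (\<mu> + L)"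
    and ciag: "ciag_iterates m f idx \<gamma> \<theta>"
    and minimizer: "is_arg_min F (\<lambda>_. True) \<theta>star"
    and V: "V = (\<lambda>k. (norm (\<theta> k - \<theta>star))\<^sup>2)"
    and c_bound: "ereal c < Min {2, step_bound_2 K \<mu> L LH (V 1), step_bound_3 K \<mu> L LH (V 1)}"
  shows "(\<exists>\<delta>\<in>{1 - 2 * \<gamma> * (\<mu> * L / (L + \<mu>))..<1}. \<forall>k\<ge>1.
            V k \<le> \<delta> ^ nat \<lceil>(real k - 1) / (2 * real K + 1)\<rceil> * V 1) \<and>
         (\<exists>Vbar. (\<forall>k\<ge>1. V k \<le> Vbar k) \<and> Vbar 1 = V 1 \<and>
            (\<forall>\<^sub>F k in sequentially. Vbar k \<noteq> 0) \<and>
            (\<exists>r. (\<lambda>k. Vbar (k + 1) / Vbar k) \<longlonglongrightarrow> r \<and>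
                 r \<le> 1 - 2 * \<gamma> * (\<mu> * L / (L + \<mu>)))) \<and>
         (\<lambda>(c::real, \<mu>::real, L::real). 2 * (c / (\<mu> + L)) * (\<mu> * L / (L + \<mu>)))
            \<in> O[principal {(c, \<mu>, L). 0 < c \<and> 0 < \<mu> \<and> \<mu> \<le> L}](\<lambda>(c, \<mu>, L). c / (L / \<mu>))"
proof -
  have V_nonneg: "0 \<le> V k" for k
    by (simp add: V)
  have c_bounds: "c < 2" "ereal c < step_bound_2 K \<mu> L LH (V 1)" "ereal c < step_bound_3 K \<mu> L LH (V 1)"
    using c_bound by auto
  have \<gamma>_bounds: "0 < \<gamma>" "\<gamma> < 2 / (\<mu> + L)"
    using c_pos const c_bounds(1) by (auto simp: \<gamma> divide_strict_right_mono)
  interpret ciag_run m K f F idx \<theta> \<theta>star LHi LH \<mu> L \<gamma>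
  proof
    show "k \<le> last_access idx i k + K" if "i \<in> {1..m}" "1 \<le> k" for i k
      using delay that by fastforce
    show "F \<theta>star \<le> F x" for x
      using minimizer by (simp add: is_arg_min_linorder)
    show "\<theta> (k + 1) = \<theta> k - \<gamma> *\<^sub>R ciag_direction m f idx \<theta> k" if "1 \<le> k" for k
      using ciag that by (simp add: ciag_iterates_def)
  qed (use assms \<gamma>_bounds in auto)
  \<comment> \<open>From c < 2, strictly, and 4 \<mu> L \<le> (\<mu> + L)^2. Positivity is needed
    later to divide by powers of \<open>rate\<close>.\<close>
  have rate_pos: "0 < rate"
  proof -
    have "2 * \<gamma> * (\<mu> * L / (L + \<mu>)) < 2 * (2 / (\<mu> + L)) * (\<mu> * L / (L + \<mu>))"
      using \<gamma>_bounds const by (intro mult_strict_right_mono mult_strict_left_mono) auto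
    also have "\<dots> = 4 * \<mu> * L / (\<mu> + L)\<^sup>2"
      by (simp add: power2_eq_square add.commute)
    also have "\<dots> \<le> 1"
    proof -
      have "4 * \<mu> * L \<le> (\<mu> + L)\<^sup>2"
        using zero_le_power2[of "\<mu> - L"] by (simp add: power2_eq_square algebra_simps)
      then show ?thesis
        using const by (subst divide_le_eq_1_pos) auto
    qed
    finally show ?thesis
      by (simp add: rate_def)
  qed
  let ?pert = "ciag_perturbation \<gamma> K L LH"
  define d where "d = norm (\<theta> 1 - \<theta>star)"
  define \<delta> where "\<delta> = rate + ?pert d"
  have V1: "V 1 = d\<^sup>2" and "0 \<le> d"
    by (simp_all add: V d_def)
  have "?pert d < 2 * \<gamma> * (\<mu> * L / (L + \<mu>))"
    using const LH_nonneg \<open>0 \<le> d\<close> c_pos \<gamma> c_bounds(2,3) unfolding V1 by (rule ciag_perturbation_less)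
  then have "\<delta> < 1"
    by (simp add: \<delta>_def rate_def)
  have "rate \<le> \<delta>"
    using ciag_perturbation_nonneg \<gamma>_bounds LH_nonneg \<open>0 \<le> d\<close> by (simp add: \<delta>_def)
  have step_V: "V (k + 1) \<le> rate * V k + ?pert s * B"
    if "1 \<le> k" "0 \<le> s" "0 \<le> B" "\<And>l. 1 \<le> l \<Longrightarrow> l \<le> k \<Longrightarrow> k \<le> l + 2 * K \<Longrightarrow> V l \<le> s\<^sup>2 \<and> V l \<le> B"
    for k s B
    unfolding V using that(1-3) that(4)[unfolded V] by (intro step_bound) (auto intro: power2_le_imp_le)
  have decay: "V k \<le> \<delta> ^ ((k - 1 + 2 * K) div (2 * K + 1)) * V 1" if "1 \<le> k" for k
  proof (rule delayed_contraction)
    fix j B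
    assume j: "1 \<le> j" and B: "0 \<le> B" "B \<le> V 1"
      and window: "\<And>l. 1 \<le> l \<Longrightarrow> l \<le> j \<Longrightarrow> j \<le> l + 2 * K \<Longrightarrow> V l \<le> B"
    have "V (j + 1) \<le> rate * V j + ?pert d * B"
      \<comment> \<open>Since \<open>B \<le> V 1\<close>, the window lies in the initial ball, so
        the coefficient can be taken at \<open>d\<close> throughout.\<close>
      using j B \<open>0 \<le> d\<close> window by (intro step_V) (auto simp flip: V1 intro: order_trans)
    also have "\<dots> \<le> rate * B + ?pert d * B"
      using window[of j] j rate_pos by simp
    finally show "V (j + 1) \<le> \<delta> * B"
      by (simp add: \<delta>_def algebra_simps)
  qed (use that V_nonneg \<open>\<delta> < 1\<close> \<open>rate \<le> \<delta>\<close> rate_pos in auto)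
  have "V k \<le> \<delta> ^ nat \<lceil>(real k - 1) / (2 * real K + 1)\<rceil> * V 1" if "1 \<le> k" for k
  proof -
    have "\<delta> ^ ((k - 1 + 2 * K) div (2 * K + 1)) \<le> \<delta> ^ nat \<lceil>(real k - 1) / (real (2 * K) + 1)\<rceil>"
      using \<open>\<delta> < 1\<close> \<open>rate \<le> \<delta>\<close> rate_pos by (intro power_decreasing ceiling_divide_le_div) auto
    then have "\<delta> ^ ((k - 1 + 2 * K) div (2 * K + 1)) * V 1
        \<le> \<delta> ^ nat \<lceil>(real k - 1) / (2 * real K + 1)\<rceil> * V 1"
      using V_nonneg[of 1] by (intro mult_right_mono) auto
    then show ?thesis
      using decay[OF that] by simp
  qed
  then have part1: "\<exists>\<delta>\<in>{1 - 2 * \<gamma> * (\<mu> * L / (L + \<mu>))..<1}. \<forall>k\<ge>1.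
      V k \<le> \<delta> ^ nat \<lceil>(real k - 1) / (2 * real K + 1)\<rceil> * V 1"
    using \<open>\<delta> < 1\<close> \<open>rate \<le> \<delta>\<close> by (intro bexI[of _ \<delta>]) (auto simp: rate_def)
  \<comment> \<open>An explicit radius for the window ending at \<open>k\<close>, tending to 0: the
    square root of the decay bound at its oldest index k - 2K.\<close>
  define s where "s k = sqrt (\<delta> ^ ((k - 1) div (2 * K + 1)) * V 1)" for k
  have s_sq: "(s k)\<^sup>2 = \<delta> ^ ((k - 1) div (2 * K + 1)) * V 1" and s_nonneg: "0 \<le> s k" for k
    using V_nonneg[of 1] \<open>rate \<le> \<delta>\<close> rate_pos by (auto simp: s_def)
  have "filterlim (\<lambda>k. (k - 1) div (2 * K + 1)) sequentially sequentially"
    unfolding filterlim_at_top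
  proof
    fix Z :: nat
    show "\<forall>\<^sub>F k in sequentially. Z \<le> (k - 1) div (2 * K + 1)"
      using eventually_ge_at_top[of "Z * (2 * K + 1) + 1"]
      by eventually_elim (auto simp: less_eq_div_iff_mult_less_eq)
  qed
  then have "(\<lambda>k. \<delta> ^ ((k - 1) div (2 * K + 1))) \<longlonglongrightarrow> 0"
    using \<open>\<delta> < 1\<close> \<open>rate \<le> \<delta>\<close> rate_pos
    by (intro filterlim_compose[OF LIMSEQ_realpow_zero]) auto
  then have "s \<longlonglongrightarrow> sqrt (0 * V 1)"
    unfolding s_def by (intro tendsto_intros)
  then have pert_lim: "(\<lambda>k. ?pert (s k)) \<longlonglongrightarrow> 0"
    unfolding ciag_perturbation_def by (auto intro!: tendsto_eq_intros)
  have "V (k + 1) \<le> rate * V k + ?pert (s k) * B"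
    if k: "1 \<le> k" and B: "0 \<le> B"
      and window: "\<And>l. 1 \<le> l \<Longrightarrow> l \<le> k \<Longrightarrow> k \<le> l + 2 * K \<Longrightarrow> V l \<le> B" for k B
  proof (rule step_V)
    fix l assume l: "1 \<le> l" "l \<le> k" "k \<le> l + 2 * K"
    have "\<delta> ^ ((l - 1 + 2 * K) div (2 * K + 1)) \<le> \<delta> ^ ((k - 1) div (2 * K + 1))"
      using l \<open>\<delta> < 1\<close> \<open>rate \<le> \<delta>\<close> rate_pos by (intro power_decreasing div_le_mono) auto
    then have "V l \<le> (s k)\<^sup>2"
      unfolding s_sq using V_nonneg[of 1]
      by (intro order_trans[OF decay[OF l(1)]] mult_right_mono)
    then show "V l \<le> (s k)\<^sup>2 \<and> V l \<le> B"
      using window l by simp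
  qed (use k B s_nonneg in auto)
  then have "\<exists>Vbar. (\<forall>k\<ge>1. V k \<le> Vbar k) \<and> Vbar 1 = V 1 \<and> (\<forall>\<^sub>F k in sequentially. Vbar k \<noteq> 0) \<and>
      (\<lambda>k. Vbar (k + 1) / Vbar k) \<longlonglongrightarrow> rate"
    using rate_pos rate_le_1 V_nonneg pert_lim s_nonneg \<gamma>_bounds LH_nonneg
    by (intro delayed_recursion_majorant[where \<epsilon> = "\<lambda>k. ?pert (s k)"] ciag_perturbation_nonneg) auto
  \<comment> \<open>The limit is \<open>rate\<close> itself, so the inequality claimed for it holds
    with equality.\<close>
  then have part2: "\<exists>Vbar. (\<forall>k\<ge>1. V k \<le> Vbar k) \<and> Vbar 1 = V 1 \<and>
      (\<forall>\<^sub>F k in sequentially. Vbar k \<noteq> 0) \<and>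
      (\<exists>r. (\<lambda>k. Vbar (k + 1) / Vbar k) \<longlonglongrightarrow> r \<and> r \<le> 1 - 2 * \<gamma> * (\<mu> * L / (L + \<mu>)))"
    unfolding rate_def by (meson order_refl)
  from part1 part2 contraction_gap_bigo show ?thesis
    by (intro conjI)
qed

end
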